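(* IKC violates the Richness, Standard Consistency, Refinement Consistency, Inter-edge Consistency, Connectivity, Pair-of-Cliques and Fixed Point axioms.
   Context: A network is a finite simple undirected unweighted graph $N=(V,E)$; a clustering is a partition of $V$ into nonempty clusters; $N[S]$ is the induced subgraph on $S\subseteq V$. For an integer $k\ge0$, the $k$-core of a graph $H$ is the subgraph obtained by repeatedly deleting vertices of degree less than $k$ (in the current subgraph) until none remain, i.e. the maximal induced subgraph of minimum degree at least $k$ (possibly empty). For a set $c$ of vertices of $N$ with $E\ne\emptyset$, its modularity score is $\frac{e_c}{|E|}-\left(\frac{d_c}{2|E|}\right)^2$, where $e_c$ is the number of edges with both endpoints in $c$ and $d_c$ the sum of the degrees in $N$ of the vertices of $c$. IKC (iterative $k$-core, with $k_0=0$): on input $N=(V,E)$, set $R=V$; while $R\neq\emptyset$: let $k$ be the largest integer such that the $k$-core of $N[R]$ is nonempty; for each connected component $c$ of this $k$-core, output $c$ as a cluster if $|c|=1$ or if its modularity score (computed in the input network $N$) is positive, and otherwise output each vertex of $c$ as a singleton cluster; then remove the vertices of the $k$-core from $R$. IKC is a deterministic method; write $M(N)$ for its output. Axioms for a deterministic method $M$: Richness: for every finite $V$ and every partition $\Gamma$ of $V$ (including $\{V\}$) there is $E$ with $M((V,E))=\Gamma$. Standard Consistency: whenever $E'$ is obtained from $E$ by deleting some edges between different clusters of $M(N)$ and/or adding some edges with both endpoints in a common cluster of $M(N)$, $M((V,E'))=M(N)$. Refinement Consistency: for such $E'$, every cluster of $M((V,E'))$ is contained in a cluster of $M(N)$.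 Inter-edge Consistency: whenever $E'$ is obtained from $E$ by only deleting edges between different clusters of $M(N)$, $M((V,E'))=M(N)$. Connectivity: there is a non-negative non-decreasing $f:\mathbb{R}^+\to\mathbb{R}^+$ with $f(x)\to\infty$ such that for every $N$ and every $c\in M(N)$ with $|c|\ge 2$, the minimum number of edges of $N[c]$ whose removal disconnects $N[c]$ is strictly greater than $f(|c|)$. Pair-of-Cliques: a pair-of-cliques component is a connected component with vertex set $A\cup B$, $A\cap B=\emptyset$, $|A|=|B|=n$, $A,B$ cliques, exactly one edge between $A$ and $B$; size $2n$. The axiom holds if there is $n_0$ such that for every $N$ and every pair-of-cliques component of size $\ge n_0$, $A$ and $B$ are clusters of $M(N)$. Fixed Point: for every $N$ and every nonempty $\mathcal{D}\subseteq M(N)$, $M(N[\bigcup\mathcal{D}])=\mathcal{D}$. *)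

theory Defs
  imports Complex_Main "HOL-Library.Disjoint_Sets" "HOL-Library.Infinite_Typeclass"
begin

section \<open>Networks\<close>

type_synonym 'a graph = "'a set \<times> 'a set set"

abbreviation verts :: "'a graph \<Rightarrow> 'a set" where "verts \<equiv> fst"
abbreviation edges :: "'a graph \<Rightarrow> 'a set set" where "edges \<equiv> snd"

definition network :: "'a graph \<Rightarrow> bool" where
  "network N \<longleftrightarrow> finite (verts N) \<and> (\<forall>e\<in>edges N. e \<subseteq> verts N \<and> card e = 2)"

definition induce :: "'a graph \<Rightarrow> 'a set \<Rightarrow> 'a graph" where
  "induce N S = (S, {e \<in> edges N. e \<subseteq> S})"

definition vdegree :: "'a graph \<Rightarrow> 'a \<Rightarrow> nat" where
  "vdegree N v = card {e \<in> edges N. v \<in> e}"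

definition reach :: "'a graph \<Rightarrow> ('a \<times> 'a) set" where
  "reach N = {(x, y). {x, y} \<in> edges N}\<^sup>* \<inter> verts N \<times> verts N"

definition connected_graph :: "'a graph \<Rightarrow> bool" where
  "connected_graph N \<longleftrightarrow> (\<forall>u\<in>verts N. \<forall>v\<in>verts N. (u, v) \<in> reach N)"

definition components :: "'a graph \<Rightarrow> 'a set set" where
  "components N = verts N // reach N"

section \<open>Cores and modularity\<close>

text \<open>
  Vertex sets inducing minimum degree at least \<open>k\<close> are closed under unions, so the union
  below is the greatest of them (lemmas \<open>k_core_min_degree\<close>, \<open>k_core_greatest\<close>);
  lemma \<open>k_core_by_deletion\<close> shows that it is what remains after exhaustively
  deleting vertices of degree less than \<open>k\<close>.
\<close>

definition k_core :: "nat \<Rightarrow> 'a graph \<Rightarrow> 'a graph" where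
  "k_core k H = induce H (\<Union>{S. S \<subseteq> verts H \<and> (\<forall>v\<in>S. k \<le> vdegree (induce H S) v)})"

text \<open>
  For \<open>edges N = {}\<close> the quotients are \<open>0\<close> by the convention \<open>x / 0 = 0\<close>; the algorithm
  consults the score only for connected \<open>c\<close> with at least two vertices, so never in that case.
\<close>

definition modularity :: "'a graph \<Rightarrow> 'a set \<Rightarrow> real" where
  "modularity N c =
     real (card {e \<in> edges N. e \<subseteq> c}) / real (card (edges N))
     - (real (\<Sum>v\<in>c. vdegree N v) / (2 * real (card (edges N))))\<^sup>2"

lemma verts_induce [simp]: "verts (induce N S) = S"
  by (simp add: induce_def)

lemma k_core_subset: "verts (k_core k H) \<subseteq> verts H"
  by (auto simp: k_core_def)

lemma vdegree_induce_mono: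
  assumes "S \<subseteq> T" "finite T"
  shows "vdegree (induce H S) v \<le> vdegree (induce H T) v"
proof -
  have "finite {e \<in> edges (induce H T). v \<in> e}"
    by (rule finite_subset[of _ "Pow T"]) (use assms in \<open>auto simp: induce_def\<close>)
  then show ?thesis
    unfolding vdegree_def by (rule card_mono) (use assms in \<open>auto simp: induce_def\<close>)
qed

lemma k_core_min_degree:
  assumes "finite (verts H)" "v \<in> verts (k_core k H)"
  shows "k \<le> vdegree (k_core k H) v"
proof -
  let ?U = "verts (k_core k H)"
  obtain S where S: "v \<in> S" "S \<subseteq> verts H" "\<forall>v\<in>S. k \<le> vdegree (induce H S) v"
    using assms(2) by (auto simp: k_core_def)
  then have "S \<subseteq> ?U" by (auto simp: k_core_def)
  moreover have "finite ?U" by (rule finite_subset[OF k_core_subset assms(1)])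
  ultimately have "vdegree (induce H S) v \<le> vdegree (induce H ?U) v"
    by (rule vdegree_induce_mono)
  moreover have "induce H ?U = k_core k H" by (simp add: k_core_def)
  ultimately show ?thesis using S(1,3) by fastforce
qed

lemma k_core_greatest:
  assumes "S \<subseteq> verts H" "\<And>v. v \<in> S \<Longrightarrow> k \<le> vdegree (induce H S) v"
  shows "S \<subseteq> verts (k_core k H)"
  using assms by (auto simp: k_core_def)

inductive deletes :: "nat \<Rightarrow> 'a graph \<Rightarrow> 'a set \<Rightarrow> bool" for k H where
  "deletes k H (verts H)"
| "deletes k H S \<Longrightarrow> v \<in> S \<Longrightarrow> vdegree (induce H S) v < k \<Longrightarrow> deletes k H (S - {v})"

lemma k_core_by_deletion:
  assumes "finite (verts H)" "deletes k H S" "\<And>v. v \<in> S \<Longrightarrow> \<not> vdegree (induce H S) v < k"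
  shows "k_core k H = induce H S"
proof -
  let ?U = "verts (k_core k H)"
  have eq: "induce H ?U = k_core k H" by (simp add: k_core_def)
  from assms(2) have "?U \<subseteq> S \<and> S \<subseteq> verts H"
  proof induction
    case 1
    show ?case by (simp add: k_core_subset)
  next
    case (2 S v)
    have "v \<notin> ?U"
    proof
      assume "v \<in> ?U"
      then have "k \<le> vdegree (induce H ?U) v" using k_core_min_degree assms(1) eq by metis
      also have "\<dots> \<le> vdegree (induce H S) v"
        using 2(4) finite_subset[OF _ assms(1)] by (intro vdegree_induce_mono) auto
      finally show False using 2 by simp
    qed
    then show ?case using 2 by blast
  qed
  moreover from this have "S \<subseteq> ?U"
    by (intro k_core_greatest) (use assms(3) in \<open>auto simp: not_less\<close>)
  ultimately show ?thesis using eq by auto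
qed

section \<open>The IKC method\<close>

definition max_core :: "'a graph \<Rightarrow> 'a graph" where
  "max_core H = k_core (GREATEST k. verts (k_core k H) \<noteq> {}) H"

definition emit :: "'a graph \<Rightarrow> 'a set \<Rightarrow> 'a set set" where
  "emit N c = (if card c = 1 \<or> modularity N c > 0 then {c} else {{v} | v. v \<in> c})"

lemma max_core_nonempty:
  assumes "finite (verts H)" "verts H \<noteq> {}"
  shows "verts (max_core H) \<noteq> {}"
  unfolding max_core_def
proof (rule GreatestI_nat)
  show "verts (k_core 0 H) \<noteq> {}"
    using assms(2) k_core_greatest[of "verts H" H 0] by auto
next
  fix k assume "verts (k_core k H) \<noteq> {}"
  then obtain v where v: "v \<in> verts (k_core k H)" by blast
  have "k \<le> card {e \<in> edges (k_core k H). v \<in> e}"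
    using k_core_min_degree[OF assms(1) v] by (simp add: vdegree_def)
  also have "\<dots> \<le> card (Pow (verts H))"
    by (rule card_mono) (use assms(1) in \<open>auto simp: k_core_def induce_def\<close>)
  finally show "k \<le> card (Pow (verts H))" .
qed

lemma max_core_subset: "verts (max_core H) \<subseteq> verts H"
  unfolding max_core_def by (rule k_core_subset)

function ikc_loop :: "'a graph \<Rightarrow> 'a set \<Rightarrow> 'a set set" where
  "ikc_loop N R =
     (if R = {} \<or> infinite R then {}
      else (\<Union>c\<in>components (max_core (induce N R)). emit N c)
           \<union> ikc_loop N (R - verts (max_core (induce N R))))"
  by pat_completeness auto
termination
proof (relation "measure (\<lambda>(N, R). card R)")
  fix N :: "'a graph" and R :: "'a set"
  assume "\<not> (R = {} \<or> infinite R)"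
  then have "R - verts (max_core (induce N R)) \<subset> R" and "finite R"
    using max_core_nonempty[of "induce N R"] max_core_subset[of "induce N R"] by auto
  then show "((N, R - verts (max_core (induce N R))), (N, R)) \<in> measure (\<lambda>(N, R). card R)"
    by (simp add: psubset_card_mono)
qed simp

declare ikc_loop.simps [simp del]

definition IKC :: "'a graph \<Rightarrow> 'a set set" where
  "IKC N = ikc_loop N (verts N)"

lemma equiv_reach: "equiv (verts N) (reach N)"
proof -
  have "sym ({(x, y). {x, y} \<in> edges N}\<^sup>*)"
    by (rule sym_rtrancl) (auto simp: sym_def insert_commute)
  then show ?thesis
    unfolding reach_def
    by (intro equivI refl_onI symI transI) (auto dest: symD intro: rtrancl_trans)
qed

lemma partition_on_emit: "c \<noteq> {} \<Longrightarrow> partition_on c (emit N c)"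
  by (auto simp: emit_def partition_on_def disjoint_def)

lemma partition_on_disjoint_union:
  assumes "partition_on A P" "partition_on B Q" "A \<inter> B = {}"
  shows "partition_on (A \<union> B) (P \<union> Q)"
  unfolding partition_on_def
proof (intro conjI)
  show "disjoint (P \<union> Q)"
    by (rule disjoint_union) (use assms in \<open>simp_all add: partition_on_def\<close>)
qed (use assms in \<open>simp_all add: partition_on_def\<close>)

lemma partition_on_ikc_loop: "finite R \<Longrightarrow> partition_on R (ikc_loop N R)"
proof (induction "card R" arbitrary: R rule: less_induct)
  case less
  show ?case
  proof (cases "R = {}")
    case True
    then show ?thesis using ikc_loop.simps[of N R] by (simp add: partition_on_empty)
  next
    case False
    let ?H = "max_core (induce N R)"
    have ne: "verts ?H \<noteq> {}" and sub: "verts ?H \<subseteq> R"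
      using max_core_nonempty[of "induce N R"] max_core_subset[of "induce N R"] less.prems False
      by auto
    have part: "partition_on (verts ?H) (components ?H)"
      unfolding components_def by (rule partition_on_quotient[OF equiv_reach])
    have em: "partition_on c (emit N c)" if "c \<in> components ?H" for c
      using that part by (intro partition_on_emit) (auto simp: partition_on_def)
    have now: "partition_on (verts ?H) (\<Union>c\<in>components ?H. emit N c)"
    proof (rule partition_onI)
      show "\<Union> (\<Union>c\<in>components ?H. emit N c) = verts ?H"
      proof -
        have "\<Union> (\<Union>c\<in>components ?H. emit N c) = (\<Union>c\<in>components ?H. \<Union> (emit N c))" by blast
        also have "\<dots> = (\<Union>c\<in>components ?H. c)" using em by (auto simp: partition_on_def)
        also have "\<dots> = verts ?H" using part by (simp add: partition_on_def)
        finally show ?thesis .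
      qed
      show "{} \<notin> (\<Union>c\<in>components ?H. emit N c)"
        using em by (auto simp: partition_on_def)
      show "disjnt p q" if pq: "p \<in> (\<Union>c\<in>components ?H. emit N c)"
        "q \<in> (\<Union>c\<in>components ?H. emit N c)" "p \<noteq> q" for p q
      proof -
        obtain c d where cd: "c \<in> components ?H" "p \<in> emit N c" "d \<in> components ?H" "q \<in> emit N d"
          using pq by blast
        have pc: "partition_on c (emit N c)" "partition_on d (emit N d)"
          using cd em by simp_all
        show ?thesis
        proof (cases "c = d")
          case True
          then show ?thesis using pc cd pq(3) unfolding partition_on_def disjoint_def disjnt_def by metis
        next
          case False
          then have "c \<inter> d = {}" using part cd unfolding partition_on_def disjoint_def by metis
          moreover have "p \<subseteq> c" "q \<subseteq> d" using pc cd unfolding partition_on_def by blast+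
          ultimately show ?thesis unfolding disjnt_def by blast
        qed
      qed
    qed
    have "card (R - verts ?H) < card R"
      using ne sub less.prems by (intro psubset_card_mono) auto
    then have "partition_on (R - verts ?H) (ikc_loop N (R - verts ?H))"
      using less by blast
    then have "partition_on (verts ?H \<union> (R - verts ?H))
        ((\<Union>c\<in>components ?H. emit N c) \<union> ikc_loop N (R - verts ?H))"
      by (rule partition_on_disjoint_union[OF now]) blast
    moreover have "verts ?H \<union> (R - verts ?H) = R" using sub by blast
    ultimately show ?thesis
      using False less.prems ikc_loop.simps[of N R] by simp
  qed
qed

lemma partition_on_IKC: "network N \<Longrightarrow> partition_on (verts N) (IKC N)"
  by (simp add: IKC_def network_def partition_on_ikc_loop)

section \<open>Axioms\<close>

definition richness :: "('a graph \<Rightarrow> 'a set set) \<Rightarrow> bool" where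
  "richness M \<longleftrightarrow>
     (\<forall>V \<Gamma>. finite V \<and> partition_on V \<Gamma> \<longrightarrow> (\<exists>E. network (V, E) \<and> M (V, E) = \<Gamma>))"

definition inter_edge :: "'a set set \<Rightarrow> 'a set \<Rightarrow> bool" where
  "inter_edge \<Gamma> e \<longleftrightarrow> (\<exists>u v. e = {u, v} \<and> (\<exists>C\<in>\<Gamma>. \<exists>D\<in>\<Gamma>. C \<noteq> D \<and> u \<in> C \<and> v \<in> D))"

definition intra_edge :: "'a set set \<Rightarrow> 'a set \<Rightarrow> bool" where
  "intra_edge \<Gamma> e \<longleftrightarrow> (\<exists>C\<in>\<Gamma>. e \<subseteq> C)"

definition consistent_change :: "'a set set \<Rightarrow> 'a graph \<Rightarrow> 'a graph \<Rightarrow> bool" where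
  "consistent_change \<Gamma> N N' \<longleftrightarrow> network N' \<and> verts N' = verts N \<and>
     (\<forall>e \<in> edges N - edges N'. inter_edge \<Gamma> e) \<and>
     (\<forall>e \<in> edges N' - edges N. intra_edge \<Gamma> e)"

definition standard_consistency :: "('a graph \<Rightarrow> 'a set set) \<Rightarrow> bool" where
  "standard_consistency M \<longleftrightarrow>
     (\<forall>N N'. network N \<and> consistent_change (M N) N N' \<longrightarrow> M N' = M N)"

definition refinement_consistency :: "('a graph \<Rightarrow> 'a set set) \<Rightarrow> bool" where
  "refinement_consistency M \<longleftrightarrow>
     (\<forall>N N'. network N \<and> consistent_change (M N) N N' \<longrightarrow> (\<forall>C \<in> M N'. \<exists>D \<in> M N. C \<subseteq> D))"

definition inter_edge_consistency :: "('a graph \<Rightarrow> 'a set set) \<Rightarrow> bool" where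
  "inter_edge_consistency M \<longleftrightarrow>
     (\<forall>V E E'. network (V, E) \<and> E' \<subseteq> E \<and> (\<forall>e \<in> E - E'. inter_edge (M (V, E)) e)
        \<longrightarrow> M (V, E') = M (V, E))"

definition min_cut :: "'a graph \<Rightarrow> nat" where
  "min_cut H = (LEAST m. \<exists>F \<subseteq> edges H. card F = m \<and> \<not> connected_graph (verts H, edges H - F))"

definition connectivity :: "('a graph \<Rightarrow> 'a set set) \<Rightarrow> bool" where
  "connectivity M \<longleftrightarrow>
     (\<exists>f :: real \<Rightarrow> real.
        (\<forall>x>0. 0 \<le> f x) \<and> mono_on {0<..} f \<and> filterlim f at_top at_top \<and>
        (\<forall>N. network N \<longrightarrow>
           (\<forall>c \<in> M N. 2 \<le> card c \<longrightarrow> f (real (card c)) < real (min_cut (induce N c)))))"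

definition clique :: "'a graph \<Rightarrow> 'a set \<Rightarrow> bool" where
  "clique N A \<longleftrightarrow> A \<subseteq> verts N \<and> (\<forall>u\<in>A. \<forall>v\<in>A. u \<noteq> v \<longrightarrow> {u, v} \<in> edges N)"

definition pair_of_cliques :: "'a graph \<Rightarrow> 'a set \<Rightarrow> 'a set \<Rightarrow> bool" where
  "pair_of_cliques N A B \<longleftrightarrow>
     A \<union> B \<in> components N \<and> A \<inter> B = {} \<and> card A = card B \<and> clique N A \<and> clique N B \<and>
     card {e \<in> edges N. \<exists>a\<in>A. \<exists>b\<in>B. e = {a, b}} = 1"

definition pair_of_cliques_axiom :: "('a graph \<Rightarrow> 'a set set) \<Rightarrow> bool" where
  "pair_of_cliques_axiom M \<longleftrightarrow>
     (\<exists>n\<^sub>0. \<forall>N A B. network N \<and> pair_of_cliques N A B \<and> n\<^sub>0 \<le> card (A \<union> B) \<longrightarrow>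
        A \<in> M N \<and> B \<in> M N)"

definition fixed_point :: "('a graph \<Rightarrow> 'a set set) \<Rightarrow> bool" where
  "fixed_point M \<longleftrightarrow>
     (\<forall>N \<D>. network N \<and> \<D> \<noteq> {} \<and> \<D> \<subseteq> M N \<longrightarrow> M (induce N (\<Union>\<D>)) = \<D>)"

end

theory Submission
  imports "HOL-Library.Ramsey" Defs
begin

text \<open>
  A union of connected components containing a fraction \<open>p\<close> of the edges has modularity
  \<open>p - p\<^sup>2\<close>. At \<open>p = 1\<close> this vanishes, so IKC never outputs the whole vertex set of a network
  with at least two vertices as a cluster; this contradicts Richness and forces IKC to split every
  connected regular network, in particular every complete graph, into singletons.

  A pair of \<open>n\<close>-cliques joined by one edge is the \<open>(n - 1)\<close>-core of any network whose other vertices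
  have degree less than \<open>n - 1\<close>, and no larger core exists. If the network has an edge elsewhere, then
  \<open>0 < p < 1\<close> and the joined cliques form one cluster. That cluster has a cut of size one, is not
  split into its two cliques, and is no longer a cluster once the network is restricted to it.
  Moreover, the network arises from a complete graph by deleting edges, all of which run between
  singleton clusters.
\<close>

section \<open>Degrees and neighbourhoods\<close>

lemma network_iff_nsets: "network N \<longleftrightarrow> finite (verts N) \<and> edges N \<subseteq> [verts N]\<^bsup>2\<^esup>"
  by (auto simp: network_def nsets_def intro: finite_subset)

lemma network_finite_edges: "network N \<Longrightarrow> finite (edges N)"
  by (meson network_iff_nsets finite_imp_finite_nsets finite_subset)

lemma doubleton_in_edges_network:
  "network N \<Longrightarrow> {u, v} \<in> edges N \<Longrightarrow> u \<in> verts N \<and> v \<in> verts N \<and> u \<noteq> v"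
  by (metis network_iff_nsets doubleton_in_nsets_2 subsetD)

lemma edge_containing:
  assumes "network N" "e \<in> edges N" "v \<in> e"
  obtains u where "e = {u, v}"
  using assms by (force simp: network_iff_nsets elim!: nsets2_E dest: subsetD)

lemma network_induce: "network N \<Longrightarrow> S \<subseteq> verts N \<Longrightarrow> network (induce N S)"
  by (auto simp: network_def induce_def intro: finite_subset)

lemma induce_verts: "network N \<Longrightarrow> induce N (verts N) = N"
  by (cases N) (auto simp: network_def induce_def)

lemma doubleton_in_edges_induce:
  "{u, v} \<in> edges (induce N S) \<longleftrightarrow> {u, v} \<in> edges N \<and> u \<in> S \<and> v \<in> S"
  by (auto simp: induce_def)

definition neighbours :: "'a graph \<Rightarrow> 'a \<Rightarrow> 'a set" where
  "neighbours N v = {u. {u, v} \<in> edges N}"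

lemma neighbours_subset: "network N \<Longrightarrow> neighbours N v \<subseteq> verts N - {v}"
  by (auto simp: neighbours_def dest: doubleton_in_edges_network)

lemma vdegree_eq_card_neighbours:
  assumes "network N"
  shows "vdegree N v = card (neighbours N v)"
proof -
  have "{e \<in> edges N. v \<in> e} = (\<lambda>u. {u, v}) ` neighbours N v"
    by (auto simp: neighbours_def elim: edge_containing[OF assms])
  moreover have "inj_on (\<lambda>u. {u, v}) (neighbours N v)"
    by (auto simp: inj_on_def doubleton_eq_iff)
  ultimately show ?thesis by (simp add: vdegree_def card_image)
qed

lemma vdegree_le_card:
  assumes "network N" "neighbours N v \<subseteq> S" "finite S"
  shows "vdegree N v \<le> card S"
  using assms by (simp add: vdegree_eq_card_neighbours card_mono)

lemma vdegree_clique: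
  assumes "network N" "clique N A" "v \<in> A"
  shows "vdegree (induce N A) v = card A - 1"
proof -
  have subset: "A \<subseteq> verts N" using assms(2) by (simp add: clique_def)
  then have "neighbours (induce N A) v = A - {v}"
    using assms neighbours_subset[OF network_induce[OF assms(1) subset], of v]
    by (auto simp: neighbours_def doubleton_in_edges_induce clique_def)
  then show ?thesis
    using vdegree_eq_card_neighbours[OF network_induce[OF assms(1) subset]] assms(3) by simp
qed

section \<open>Connected components\<close>

abbreviation adjacency :: "'a graph \<Rightarrow> ('a \<times> 'a) set" where
  "adjacency N \<equiv> {(x, y). {x, y} \<in> edges N}"

definition edge_closed :: "'a graph \<Rightarrow> 'a set \<Rightarrow> bool" where
  "edge_closed N S \<longleftrightarrow> S \<subseteq> verts N \<and> (\<forall>e\<in>edges N. e \<inter> S \<noteq> {} \<longrightarrow> e \<subseteq> S)"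

lemma edge_closed_verts: "network N \<Longrightarrow> edge_closed N (verts N)"
  by (auto simp: edge_closed_def network_def)

lemma edge_closed_reachable:
  assumes "(u, v) \<in> (adjacency N)\<^sup>*" "edge_closed N S" "u \<in> S"
  shows "v \<in> S"
  using assms by induction (auto simp: edge_closed_def)

lemma reach_mono: "verts N \<subseteq> verts N' \<Longrightarrow> edges N \<subseteq> edges N' \<Longrightarrow> reach N \<subseteq> reach N'"
  unfolding reach_def by (intro Int_mono rtrancl_mono) auto

lemma reach_induce_subset: "S \<subseteq> T \<Longrightarrow> reach (induce N S) \<subseteq> reach (induce N T)"
  by (rule reach_mono) (auto simp: induce_def)

lemma edge_in_reach: "{u, v} \<in> edges N \<Longrightarrow> u \<in> verts N \<Longrightarrow> v \<in> verts N \<Longrightarrow> (u, v) \<in> reach N"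
  by (auto simp: reach_def)

lemma connected_graph_from_root:
  assumes "\<And>v. v \<in> verts N \<Longrightarrow> (r, v) \<in> reach N"
  shows "connected_graph N"
  unfolding connected_graph_def
  using assms equiv_reach[of N] by (meson equivE symD transD)

lemma connected_graph_edge_closed:
  assumes "connected_graph N" "edge_closed N S" "S \<noteq> {}"
  shows "S = verts N"
proof -
  obtain r where "r \<in> S" using assms(3) by blast
  then have "v \<in> S" if "v \<in> verts N" for v
    using that assms edge_closed_reachable[of r v N S]
    by (auto simp: connected_graph_def reach_def edge_closed_def)
  then show ?thesis using assms(2) by (auto simp: edge_closed_def)
qed

lemma connected_graph_clique: "clique N A \<Longrightarrow> connected_graph (induce N A)"
  by (fastforce simp: connected_graph_def reach_def clique_def doubleton_in_edges_induce)

lemma connected_graph_join: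
  assumes "connected_graph (induce N A)" "connected_graph (induce N B)"
    and "{a, b} \<in> edges N" "a \<in> A" "b \<in> B"
  shows "connected_graph (induce N (A \<union> B))"
proof (rule connected_graph_from_root)
  let ?R = "reach (induce N (A \<union> B))"
  have "reach (induce N A) \<subseteq> ?R" "reach (induce N B) \<subseteq> ?R"
    by (auto intro!: reach_induce_subset del: subsetI)
  then have from_a: "\<forall>v\<in>A. (a, v) \<in> ?R" and from_b: "\<forall>v\<in>B. (b, v) \<in> ?R"
    using assms by (auto simp: connected_graph_def)
  have "(a, b) \<in> ?R"
    using assms by (intro edge_in_reach) (auto simp: doubleton_in_edges_induce)
  then show "(a, v) \<in> ?R" if "v \<in> verts (induce N (A \<union> B))" for v
    using that from_a from_b equiv_reach[of "induce N (A \<union> B)"] by (auto elim!: equivE dest: transD)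
qed

lemma reach_Image_induce:
  assumes "network N" "(r, v) \<in> reach N"
  shows "(r, v) \<in> reach (induce N (reach N `` {r}))"
proof -
  let ?c = "reach N `` {r}"
  have root: "r \<in> verts N" using assms(2) by (simp add: reach_def)
  have "(r, v) \<in> (adjacency N)\<^sup>*" using assms(2) by (simp add: reach_def)
  then have "(r, v) \<in> (adjacency (induce N ?c))\<^sup>*"
  proof induction
    case (step y z)
    then have "y \<in> verts N" "z \<in> verts N" using assms(1) by (auto simp: network_def)
    then have "y \<in> ?c" "z \<in> ?c"
      using step.hyps root by (auto simp: reach_def intro: rtrancl_into_rtrancl)
    then show ?case
      using step by (auto simp: doubleton_in_edges_induce intro: rtrancl_into_rtrancl)
  qed simp
  then show ?thesis using assms(2) root by (auto simp: reach_def)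
qed

lemma edge_closed_reach_Image:
  assumes "network N"
  shows "edge_closed N (reach N `` {r})"
  unfolding edge_closed_def
proof (intro conjI ballI impI)
  fix e assume edge: "e \<in> edges N" "e \<inter> reach N `` {r} \<noteq> {}"
  then obtain u where reached: "u \<in> e" "(r, u) \<in> reach N" by blast
  obtain v where endpoints: "e = {v, u}" by (rule edge_containing[OF assms edge(1) reached(1)])
  then have "(u, v) \<in> reach N"
    using edge(1) doubleton_in_edges_network[OF assms, of v u]
    by (intro edge_in_reach) (simp_all add: insert_commute)
  then show "e \<subseteq> reach N `` {r}"
    using reached endpoints equiv_reach[of N] by (auto elim!: equivE dest: transD)
qed (auto simp: reach_def)

lemma components_iff:
  assumes "network N"
  shows "c \<in> components N \<longleftrightarrow> c \<noteq> {} \<and> edge_closed N c \<and> connected_graph (induce N c)"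
proof
  assume "c \<in> components N"
  then obtain r where root: "r \<in> verts N" "c = reach N `` {r}"
    by (auto simp: components_def quotient_def)
  moreover from root have "r \<in> c" by (simp add: reach_def)
  moreover have "connected_graph (induce N c)"
    using root reach_Image_induce[OF assms] by (intro connected_graph_from_root[of _ r]) auto
  ultimately show "c \<noteq> {} \<and> edge_closed N c \<and> connected_graph (induce N c)"
    using edge_closed_reach_Image[OF assms] by blast
next
  assume closed_connected: "c \<noteq> {} \<and> edge_closed N c \<and> connected_graph (induce N c)"
  then obtain r where root: "r \<in> c" by blast
  have "reach (induce N c) \<subseteq> reach N"
    using closed_connected by (intro reach_mono) (auto simp: induce_def edge_closed_def)
  then have "c \<subseteq> reach N `` {r}" using closed_connected root by (auto simp: connected_graph_def)
  moreover have "reach N `` {r} \<subseteq> c"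
    using closed_connected root edge_closed_reachable[of r _ N c] by (auto simp: reach_def)
  ultimately have "c = reach N `` {r}" by blast
  moreover have "r \<in> verts N" using closed_connected root by (auto simp: edge_closed_def)
  ultimately show "c \<in> components N" by (auto simp: components_def intro: quotientI)
qed

lemma components_connected:
  assumes "network N" "connected_graph N" "verts N \<noteq> {}"
  shows "components N = {verts N}"
proof (rule set_eqI)
  fix c
  show "c \<in> components N \<longleftrightarrow> c \<in> {verts N}"
    using assms connected_graph_edge_closed[OF assms(2), of c]
    by (auto simp: components_iff edge_closed_verts induce_verts)
qed

lemma min_cut_le_card:
  assumes "F \<subseteq> edges H" "\<not> connected_graph (verts H, edges H - F)"
  shows "min_cut H \<le> card F"
  unfolding min_cut_def by (rule Least_le) (use assms in blast)

section \<open>Modularity\<close>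

lemma sum_vdegree:
  assumes "network N" "finite c"
  shows "(\<Sum>v\<in>c. vdegree N v) = (\<Sum>e\<in>edges N. card (e \<inter> c))"
  unfolding vdegree_def
  by (rule sum_multicount_gen)
    (use assms network_finite_edges[OF assms(1)] in \<open>auto intro!: arg_cong[where f = card]\<close>)

lemma sum_vdegree_edge_closed:
  assumes "network N" "edge_closed N c"
  shows "(\<Sum>v\<in>c. vdegree N v) = 2 * card {e \<in> edges N. e \<subseteq> c}"
proof -
  have "finite c" using assms by (auto simp: network_def edge_closed_def intro: finite_subset)
  then have "(\<Sum>v\<in>c. vdegree N v) = (\<Sum>e\<in>edges N. card (e \<inter> c))"
    by (rule sum_vdegree[OF assms(1)])
  also have "\<dots> = (\<Sum>e\<in>edges N. if e \<subseteq> c then 2 else 0)"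
  proof (rule sum.cong)
    fix e assume edge: "e \<in> edges N"
    then consider "e \<inter> c = e" "e \<subseteq> c" | "e \<inter> c = {}" "\<not> e \<subseteq> c"
      using assms by (fastforce simp: edge_closed_def network_def)
    then show "card (e \<inter> c) = (if e \<subseteq> c then 2 else 0)"
      by cases (use edge assms(1) in \<open>simp_all add: network_def\<close>)
  qed simp
  also have "\<dots> = 2 * card {e \<in> edges N. e \<subseteq> c}"
    using network_finite_edges[OF assms(1)] by (simp add: sum.inter_filter[symmetric])
  finally show ?thesis .
qed

lemma modularity_edge_closed:
  assumes "network N" "edge_closed N c"
  defines "p \<equiv> real (card {e \<in> edges N. e \<subseteq> c}) / real (card (edges N))"
  shows "modularity N c = p - p\<^sup>2"
proof -
  have "real (\<Sum>v\<in>c. vdegree N v) = 2 * real (card {e \<in> edges N. e \<subseteq> c})"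
    using sum_vdegree_edge_closed[OF assms(1,2)] by simp
  then show ?thesis
    unfolding modularity_def p_def by (simp only: mult_divide_mult_cancel_left_if) simp
qed

lemma modularity_pos_iff:
  assumes "network N" "edge_closed N c"
  shows "0 < modularity N c \<longleftrightarrow> (\<exists>e\<in>edges N. e \<subseteq> c) \<and> (\<exists>e\<in>edges N. \<not> e \<subseteq> c)"
proof -
  let ?I = "{e \<in> edges N. e \<subseteq> c}"
  define p where "p = real (card ?I) / real (card (edges N))"
  have fin: "finite (edges N)" by (rule network_finite_edges[OF assms(1)])
  then have p_pos: "0 < p \<longleftrightarrow> ?I \<noteq> {}"
    using fin by (auto simp: p_def zero_less_divide_iff card_gt_0_iff)
  have "p < 1 \<longleftrightarrow> card ?I < card (edges N) \<or> edges N = {}"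
    using fin by (auto simp: p_def divide_less_eq_1 card_gt_0_iff)
  also have "\<dots> \<longleftrightarrow> ?I \<noteq> edges N \<or> edges N = {}"
    using fin psubset_card_mono[of "edges N" ?I] by auto
  finally have p_less: "p < 1 \<longleftrightarrow> ?I \<noteq> edges N \<or> edges N = {}" .
  have "0 \<le> p" by (simp add: p_def)
  have "modularity N c = p * (1 - p)"
    using modularity_edge_closed[OF assms]
    by (simp add: p_def[symmetric] power2_eq_square algebra_simps)
  then have "0 < modularity N c \<longleftrightarrow> 0 < p * (1 - p)" by simp
  also have "\<dots> \<longleftrightarrow> 0 < p \<and> p < 1"
    using \<open>0 \<le> p\<close> by (auto simp: zero_less_mult_iff)
  also have "\<dots> \<longleftrightarrow> (\<exists>e\<in>edges N. e \<subseteq> c) \<and> (\<exists>e\<in>edges N. \<not> e \<subseteq> c)"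
    unfolding p_pos p_less by blast
  finally show ?thesis .
qed

lemma not_modularity_verts_pos: "network N \<Longrightarrow> \<not> 0 < modularity N (verts N)"
  by (auto simp: modularity_pos_iff edge_closed_verts network_def)

section \<open>Cores\<close>

lemma induce_verts_k_core: "induce H (verts (k_core k H)) = k_core k H"
  by (simp add: k_core_def)

lemma network_k_core: "network H \<Longrightarrow> network (k_core k H)"
  by (metis induce_verts_k_core k_core_subset network_induce)

lemma k_core_antimono:
  assumes "finite (verts H)" "j \<le> k"
  shows "verts (k_core k H) \<subseteq> verts (k_core j H)"
proof (rule k_core_greatest[OF k_core_subset])
  fix v assume "v \<in> verts (k_core k H)"
  then show "j \<le> vdegree (induce H (verts (k_core k H))) v"
    using k_core_min_degree[OF assms(1)] assms(2) by (fastforce simp: induce_verts_k_core)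
qed

lemma k_core_le_vdegree:
  assumes "network H" "v \<in> verts (k_core k H)"
  shows "k \<le> vdegree H v"
proof -
  have fin: "finite (verts H)" using assms(1) by (simp add: network_def)
  then have "k \<le> vdegree (k_core k H) v" by (rule k_core_min_degree[OF _ assms(2)])
  also have "\<dots> \<le> vdegree (induce H (verts H)) v"
    using vdegree_induce_mono[OF k_core_subset[of k H] fin, of H v] by (simp add: induce_verts_k_core)
  finally show ?thesis using assms(1) by (simp add: induce_verts)
qed

lemma k_core_less_card:
  assumes "network H" "verts (k_core k H) \<noteq> {}"
  shows "k < card (verts (k_core k H))"
proof -
  let ?U = "verts (k_core k H)"
  obtain v where vertex: "v \<in> ?U" using assms(2) by blast
  have net: "network (k_core k H)" by (rule network_k_core[OF assms(1)])
  then have fin: "finite ?U" by (simp add: network_def)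
  have "k \<le> vdegree (k_core k H) v"
    using k_core_min_degree[OF _ vertex] assms(1) by (simp add: network_def)
  also have "\<dots> \<le> card (?U - {v})"
    using net fin by (intro vdegree_le_card neighbours_subset) auto
  also have "\<dots> < card ?U" using vertex fin by (rule card_Diff1_less[rotated])
  finally show ?thesis .
qed

lemma clique_subset_k_core:
  assumes "network H" "clique H A" "k < card A"
  shows "A \<subseteq> verts (k_core k H)"
  using assms by (intro k_core_greatest) (auto simp: vdegree_clique clique_def)

lemma max_core_eq_k_core:
  assumes "finite (verts H)" "verts (k_core k H) \<noteq> {}" "verts (k_core (Suc k) H) = {}"
  shows "max_core H = k_core k H"
proof -
  have "j \<le> k" if "verts (k_core j H) \<noteq> {}" for j
    using that k_core_antimono[OF assms(1), of "Suc k" j] assms(3)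
    by (metis not_less_eq_eq subset_empty)
  then have "(GREATEST j. verts (k_core j H) \<noteq> {}) = k"
    by (intro Greatest_equality assms(2))
  then show ?thesis by (simp add: max_core_def)
qed

lemma max_core_regular:
  assumes "network N" "verts N \<noteq> {}" "\<And>v. v \<in> verts N \<Longrightarrow> vdegree N v = k"
  shows "max_core N = N"
proof -
  have "verts N \<subseteq> verts (k_core k N)"
    using assms by (intro k_core_greatest) (auto simp: induce_verts)
  then have core: "verts (k_core k N) = verts N" by (intro equalityI k_core_subset)
  have "verts (k_core (Suc k) N) = {}"
    using k_core_le_vdegree[OF assms(1), of _ "Suc k"] k_core_subset[of "Suc k" N] assms(3)
    by fastforce
  then have "max_core N = k_core k N"
    using assms(1,2) core by (intro max_core_eq_k_core) (auto simp: network_def)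
  also have "\<dots> = N"
    using core induce_verts[OF assms(1)] by (metis induce_verts_k_core)
  finally show ?thesis .
qed

section \<open>Clusters of IKC\<close>

lemma ikc_loop_cluster: "c \<in> ikc_loop N R \<Longrightarrow> card c = 1 \<or> modularity N c > 0"
proof (induction N R rule: ikc_loop.induct)
  case (1 N R)
  then show ?case
    by (subst (asm) (2) ikc_loop.simps) (auto simp: emit_def split: if_splits)
qed

lemma verts_notin_IKC: "network N \<Longrightarrow> card (verts N) \<noteq> 1 \<Longrightarrow> verts N \<notin> IKC N"
  using ikc_loop_cluster not_modularity_verts_pos by (fastforce simp: IKC_def)

lemma IKC_unfold:
  assumes "network N" "verts N \<noteq> {}"
  shows "IKC N = (\<Union>c\<in>components (max_core N). emit N c)
    \<union> ikc_loop N (verts N - verts (max_core N))"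
  using assms ikc_loop.simps[of N "verts N"] by (simp add: IKC_def induce_verts network_def)

lemma IKC_connected_regular:
  assumes "network N" "connected_graph N" "\<And>v. v \<in> verts N \<Longrightarrow> vdegree N v = k"
  shows "IKC N = (\<lambda>v. {v}) ` verts N"
proof (cases "verts N = {}")
  case True
  then show ?thesis by (simp add: IKC_def ikc_loop.simps)
next
  case False
  then have "max_core N = N" using assms(1,3) by (intro max_core_regular)
  then have "IKC N = emit N (verts N)"
    using IKC_unfold[OF assms(1) False] components_connected[OF assms(1,2) False]
    by (simp add: ikc_loop.simps)
  also have "\<dots> = (\<lambda>v. {v}) ` verts N"
    using not_modularity_verts_pos[OF assms(1)] by (auto simp: emit_def card_1_singleton_iff)
  finally show ?thesis .
qed

definition complete_graph :: "'a set \<Rightarrow> 'a graph" where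
  "complete_graph V = (V, [V]\<^bsup>2\<^esup>)"

lemma network_complete_graph: "finite V \<Longrightarrow> network (complete_graph V)"
  by (simp add: network_iff_nsets complete_graph_def)

lemma IKC_complete_graph:
  assumes "finite V"
  shows "IKC (complete_graph V) = (\<lambda>v. {v}) ` V"
proof -
  let ?K = "complete_graph V"
  have net: "network ?K" by (rule network_complete_graph[OF assms])
  have verts: "verts ?K = V" by (simp add: complete_graph_def)
  have clique: "clique ?K V" by (simp add: clique_def complete_graph_def)
  have induce: "induce ?K V = ?K" using induce_verts[OF net] verts by simp
  have "vdegree ?K v = card V - 1" if "v \<in> V" for v
    using vdegree_clique[OF net clique that] induce by simp
  moreover have "connected_graph ?K" using connected_graph_clique[OF clique] induce by simp
  ultimately show ?thesis using IKC_connected_regular[OF net] verts by auto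
qed

lemma inter_edge_singletons: "e \<in> [V]\<^bsup>2\<^esup> \<Longrightarrow> inter_edge ((\<lambda>v. {v}) ` V) e"
  by (fastforce simp: inter_edge_def elim!: nsets2_E)

lemma inter_edge_IKC_complete_graph:
  assumes "finite V" "e \<in> [V]\<^bsup>2\<^esup>"
  shows "inter_edge (IKC (complete_graph V)) e"
  using assms by (simp add: IKC_complete_graph inter_edge_singletons)

lemma consistent_change_complete_graph:
  assumes "network N"
  shows "consistent_change (IKC (complete_graph (verts N))) (complete_graph (verts N)) N"
  using assms inter_edge_IKC_complete_graph[of "verts N"]
  by (auto simp: consistent_change_def complete_graph_def network_iff_nsets)

section \<open>Pairs of cliques\<close>

lemma pair_of_cliques_sym: "pair_of_cliques N A B \<Longrightarrow> pair_of_cliques N B A"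
proof -
  have "{e \<in> edges N. \<exists>b\<in>B. \<exists>a\<in>A. e = {b, a}} = {e \<in> edges N. \<exists>a\<in>A. \<exists>b\<in>B. e = {a, b}}"
    by (auto simp: insert_commute)
  then show "pair_of_cliques N A B \<Longrightarrow> pair_of_cliques N B A"
    by (simp add: pair_of_cliques_def Un_commute Int_commute)
qed

lemma pair_of_cliques_bridge:
  assumes "pair_of_cliques N A B"
  obtains a b where "a \<in> A" "b \<in> B" "{a, b} \<in> edges N"
    "\<forall>u\<in>A. \<forall>v\<in>B. {u, v} \<in> edges N \<longrightarrow> u = a \<and> v = b"
proof -
  let ?X = "{e \<in> edges N. \<exists>a\<in>A. \<exists>b\<in>B. e = {a, b}}"
  have disj: "A \<inter> B = {}" using assms by (simp add: pair_of_cliques_def)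
  obtain e where unique: "?X = {e}" using assms by (auto simp: pair_of_cliques_def card_1_singleton_iff)
  then have "e \<in> ?X" by simp
  then obtain a b where bridge: "a \<in> A" "b \<in> B" "{a, b} \<in> edges N" "e = {a, b}" by blast
  have "u = a \<and> v = b" if "u \<in> A" "v \<in> B" "{u, v} \<in> edges N" for u v
  proof -
    have "{u, v} \<in> ?X" using that by blast
    then have "{u, v} = {a, b}" using unique bridge(4) by simp
    then show ?thesis using that bridge disj by (auto simp: doubleton_eq_iff)
  qed
  then show thesis using that bridge by blast
qed

lemma pair_of_cliques_edge_closed:
  "network N \<Longrightarrow> pair_of_cliques N A B \<Longrightarrow> edge_closed N (A \<union> B)"
  by (simp add: pair_of_cliques_def components_iff)

lemma pair_of_cliques_finite:
  "network N \<Longrightarrow> pair_of_cliques N A B \<Longrightarrow> finite A \<and> finite B"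
  by (auto simp: pair_of_cliques_def clique_def network_def intro: finite_subset)

lemma card_pair_of_cliques:
  "network N \<Longrightarrow> pair_of_cliques N A B \<Longrightarrow> card (A \<union> B) = 2 * card A"
  by (frule (1) pair_of_cliques_finite) (simp add: pair_of_cliques_def card_Un_disjoint)

lemma pair_of_cliques_vdegree_less:
  assumes "network N" "pair_of_cliques N A B" "v \<in> A" "neighbours N v \<inter> B = {}"
  shows "vdegree N v < card A"
proof -
  have "neighbours N v \<subseteq> A \<union> B"
    using pair_of_cliques_edge_closed[OF assms(1,2)] assms(3)
    by (fastforce simp: edge_closed_def neighbours_def)
  then have "neighbours N v \<subseteq> A - {v}" using assms(4) neighbours_subset[OF assms(1)] by blast
  moreover have fin: "finite A" using pair_of_cliques_finite[OF assms(1,2)] by simp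
  ultimately have "vdegree N v \<le> card (A - {v})"
    using assms(1) by (intro vdegree_le_card) auto
  also have "\<dots> < card A" by (rule card_Diff1_less[OF fin assms(3)])
  finally show ?thesis .
qed

lemma min_cut_pair_of_cliques:
  assumes "network N" "pair_of_cliques N A B"
  shows "min_cut (induce N (A \<union> B)) \<le> 1"
proof -
  obtain a b where a_in: "a \<in> A" and b_in: "b \<in> B" and edge_ab: "{a, b} \<in> edges N"
    and bridge: "\<forall>u\<in>A. \<forall>v\<in>B. {u, v} \<in> edges N \<longrightarrow> u = a \<and> v = b"
    by (rule pair_of_cliques_bridge[OF assms(2)])
  let ?H = "induce N (A \<union> B)" and ?F = "{{a, b}}"
  let ?H' = "(verts ?H, edges ?H - ?F)"
  have "edge_closed ?H' A"
    unfolding edge_closed_def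
  proof (intro conjI ballI impI)
    fix e assume edge: "e \<in> edges ?H'" "e \<inter> A \<noteq> {}"
    then have "card e = 2" using assms(1) by (simp add: induce_def network_def)
    then obtain u v where endpoints: "e = {u, v}" "u \<in> A" using edge(2) by (auto simp: card_2_iff)
    then have "v \<in> A \<union> B" "{u, v} \<in> edges N" "{u, v} \<noteq> {a, b}"
      using edge(1) by (auto simp: induce_def)
    then show "e \<subseteq> A" using bridge endpoints by blast
  qed simp
  moreover have "A \<noteq> {}" "A \<noteq> verts ?H'"
    using a_in b_in assms(2) by (auto simp: pair_of_cliques_def)
  ultimately have "\<not> connected_graph ?H'" using connected_graph_edge_closed by blast
  moreover have "?F \<subseteq> edges ?H" using a_in b_in edge_ab by (simp add: doubleton_in_edges_induce)
  ultimately have "min_cut ?H \<le> card ?F" by (intro min_cut_le_card)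
  then show ?thesis by simp
qed

locale dominant_pair_of_cliques =
  fixes N :: "'a graph" and A B :: "'a set"
  assumes network: "network N"
    and pair: "pair_of_cliques N A B"
    and vdegree_outside: "\<And>v. v \<in> verts N - (A \<union> B) \<Longrightarrow> vdegree N v < card A - 1"
    and edge_outside: "\<exists>e\<in>edges N. \<not> e \<subseteq> A \<union> B"
begin

lemma card_B: "card B = card A"
  using pair by (simp add: pair_of_cliques_def)

lemma two_less_card: "2 < card A"
proof -
  obtain e v where outside: "e \<in> edges N" "v \<in> e" "v \<notin> A \<union> B" using edge_outside by blast
  then have "{e} \<subseteq> {e \<in> edges N. v \<in> e}" by simp
  then have "card {e} \<le> vdegree N v"
    unfolding vdegree_def by (rule card_mono[rotated]) (simp add: network_finite_edges[OF network])
  moreover have "vdegree N v < card A - 1"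
    using outside network by (intro vdegree_outside) (auto simp: network_def)
  ultimately show ?thesis by simp
qed

lemma verts_k_core: "verts (k_core (card A - 1) N) = A \<union> B"
proof
  show "verts (k_core (card A - 1) N) \<subseteq> A \<union> B"
    using k_core_le_vdegree[OF network] k_core_subset[of _ N] vdegree_outside
    by (meson Diff_iff in_mono not_less subsetI)
  have "clique N A" "clique N B" using pair by (auto simp: pair_of_cliques_def)
  then show "A \<union> B \<subseteq> verts (k_core (card A - 1) N)"
    using clique_subset_k_core[OF network] two_less_card card_B by simp
qed

text \<open>Only the ends of the bridge have degree \<open>card A\<close>, too few vertices to form a core.\<close>

lemma k_core_card_empty: "verts (k_core (card A) N) = {}"
proof (rule ccontr)
  let ?U = "verts (k_core (card A) N)"
  assume nonempty: "?U \<noteq> {}"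
  obtain a b where bridge: "\<forall>u\<in>A. \<forall>v\<in>B. {u, v} \<in> edges N \<longrightarrow> u = a \<and> v = b"
    by (rule pair_of_cliques_bridge[OF pair])
  have "vdegree N v < card A" if "v \<in> A" "v \<noteq> a" for v
    by (rule pair_of_cliques_vdegree_less[OF network pair])
      (use that bridge in \<open>auto simp: neighbours_def insert_commute\<close>)
  moreover have "vdegree N v < card A" if "v \<in> B" "v \<noteq> b" for v
    unfolding card_B[symmetric]
    by (rule pair_of_cliques_vdegree_less[OF network pair_of_cliques_sym[OF pair]])
      (use that bridge in \<open>auto simp: neighbours_def\<close>)
  moreover have "?U \<subseteq> A \<union> B"
    using k_core_antimono[of N "card A - 1" "card A"] network verts_k_core
    by (simp add: network_def)
  ultimately have "?U \<subseteq> {a, b}"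
    using k_core_le_vdegree[OF network, of _ "card A"] by fastforce
  then have "card ?U \<le> card {a, b}" by (intro card_mono) auto
  also have "\<dots> \<le> 2" by (simp add: card_insert_if)
  finally show False using k_core_less_card[OF network nonempty] two_less_card by simp
qed

lemma max_core_eq: "max_core N = induce N (A \<union> B)"
proof -
  have "max_core N = k_core (card A - 1) N"
    by (rule max_core_eq_k_core)
      (use network verts_k_core k_core_card_empty two_less_card in \<open>auto simp: network_def\<close>)
  then show ?thesis by (metis induce_verts_k_core verts_k_core)
qed

lemma Un_in_IKC: "A \<union> B \<in> IKC N"
proof -
  have component: "A \<union> B \<noteq> {}" "edge_closed N (A \<union> B)"
    "connected_graph (induce N (A \<union> B))"
    using pair by (simp_all add: pair_of_cliques_def components_iff[OF network])
  then have "A \<union> B \<subseteq> verts N" by (simp add: edge_closed_def)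
  then have "components (max_core N) = {A \<union> B}"
    using component network_induce[OF network]
    by (simp add: max_core_eq components_connected)
  moreover obtain a b where "a \<in> A" "b \<in> B" "{a, b} \<in> edges N"
    by (rule pair_of_cliques_bridge[OF pair])
  then have "\<exists>e\<in>edges N. e \<subseteq> A \<union> B" by (intro bexI[of _ "{a, b}"]) auto
  then have "0 < modularity N (A \<union> B)"
    using edge_outside by (simp add: modularity_pos_iff[OF network component(2)])
  ultimately show ?thesis
    using IKC_unfold[OF network] component(1) \<open>A \<union> B \<subseteq> verts N\<close> by (auto simp: emit_def)
qed

lemma clique_notin_IKC: "A \<notin> IKC N"
proof
  assume "A \<in> IKC N"
  moreover have "A \<noteq> {}" using two_less_card by auto
  moreover have "A \<noteq> A \<union> B"
  proof
    assume "A = A \<union> B"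
    moreover have "card (A \<union> B) = 2 * card A" by (rule card_pair_of_cliques[OF network pair])
    ultimately show False using two_less_card by simp
  qed
  ultimately show False
    using disjointD[OF partition_onD2[OF partition_on_IKC[OF network]] _ Un_in_IKC, of A] by auto
qed

lemma Un_not_subset_cluster_complete_graph:
  assumes "D \<in> IKC (complete_graph (verts N))"
  shows "\<not> A \<union> B \<subseteq> D"
proof
  assume subset: "A \<union> B \<subseteq> D"
  have "finite (verts N)" using network by (simp add: network_def)
  then obtain v where "D = {v}" using assms by (auto simp: IKC_complete_graph)
  then have "card (A \<union> B) \<le> 1" using card_mono[OF _ subset] by simp
  then show False using card_pair_of_cliques[OF network pair] two_less_card by simp
qed

lemma not_refinement_consistency_IKC:
  "\<not> refinement_consistency (IKC :: 'a graph \<Rightarrow> 'a set set)"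
proof
  assume "refinement_consistency (IKC :: 'a graph \<Rightarrow> 'a set set)"
  moreover have "network (complete_graph (verts N))"
    using network by (intro network_complete_graph) (simp add: network_def)
  ultimately have "\<exists>D\<in>IKC (complete_graph (verts N)). A \<union> B \<subseteq> D"
    using consistent_change_complete_graph[OF network] Un_in_IKC
    unfolding refinement_consistency_def by blast
  then show False using Un_not_subset_cluster_complete_graph by blast
qed

lemma not_inter_edge_consistency_IKC:
  "\<not> inter_edge_consistency (IKC :: 'a graph \<Rightarrow> 'a set set)"
proof
  assume consistent: "inter_edge_consistency (IKC :: 'a graph \<Rightarrow> 'a set set)"
  let ?V = "verts N"
  have fin: "finite ?V" and edges: "edges N \<subseteq> [?V]\<^bsup>2\<^esup>"
    using network by (simp_all add: network_iff_nsets)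
  have "IKC (?V, edges N) = IKC (?V, [?V]\<^bsup>2\<^esup>)"
    using consistent edges network_complete_graph[OF fin] inter_edge_IKC_complete_graph[OF fin]
    unfolding inter_edge_consistency_def complete_graph_def by blast
  then have "A \<union> B \<in> IKC (complete_graph ?V)"
    using Un_in_IKC by (simp add: complete_graph_def)
  then show False using Un_not_subset_cluster_complete_graph by blast
qed

lemma not_fixed_point_IKC: "\<not> fixed_point (IKC :: 'a graph \<Rightarrow> 'a set set)"
proof
  let ?H = "induce N (A \<union> B)"
  assume "fixed_point (IKC :: 'a graph \<Rightarrow> 'a set set)"
  then have "IKC (induce N (\<Union>{A \<union> B})) = {A \<union> B}"
    using network Un_in_IKC unfolding fixed_point_def by blast
  then have "verts ?H \<in> IKC ?H" by simp
  moreover have "network ?H"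
    using pair_of_cliques_edge_closed[OF network pair]
    by (intro network_induce[OF network]) (simp add: edge_closed_def)
  ultimately show False
    using verts_notin_IKC[of ?H] card_pair_of_cliques[OF network pair] by simp
qed

end

section \<open>Two joined cliques and a separate edge\<close>

locale joined_cliques =
  fixes A B :: "'a set" and a b x y :: 'a
  assumes finite_cliques: "finite A" "finite B"
    and card_eq: "card A = card B" and card_ge: "3 \<le> card A"
    and disjoint: "A \<inter> B = {}" and bridge: "a \<in> A" "b \<in> B"
    and outside: "x \<notin> A \<union> B" "y \<notin> A \<union> B" "x \<noteq> y"
begin

definition joined_graph :: "'a graph" where
  "joined_graph = (A \<union> B \<union> {x, y}, [A]\<^bsup>2\<^esup> \<union> [B]\<^bsup>2\<^esup> \<union> {{a, b}, {x, y}})"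

lemma doubleton_in_edges:
  "{u, v} \<in> edges joined_graph \<longleftrightarrow>
    {u, v} \<in> [A]\<^bsup>2\<^esup> \<or> {u, v} \<in> [B]\<^bsup>2\<^esup> \<or> {u, v} = {a, b} \<or> {u, v} = {x, y}"
  by (simp add: joined_graph_def disj_ac)

lemma network_joined_graph: "network joined_graph"
proof -
  have "[A]\<^bsup>2\<^esup> \<union> [B]\<^bsup>2\<^esup> \<subseteq> [A \<union> B \<union> {x, y}]\<^bsup>2\<^esup>" by (intro Un_least nsets_mono) auto
  moreover have "a \<noteq> b" using bridge disjoint by auto
  ultimately show ?thesis
    using finite_cliques bridge outside by (simp add: network_iff_nsets joined_graph_def)
qed

lemma pair_of_cliques_joined_graph: "pair_of_cliques joined_graph A B"
proof -
  have "clique joined_graph A" "clique joined_graph B"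
    by (auto simp: clique_def joined_graph_def)
  moreover have "A \<union> B \<in> components joined_graph"
    unfolding components_iff[OF network_joined_graph]
  proof (intro conjI)
    show "edge_closed joined_graph (A \<union> B)"
      using bridge outside by (auto simp: edge_closed_def joined_graph_def nsets_def)
    have "{a, b} \<in> edges joined_graph" by (simp add: joined_graph_def)
    then show "connected_graph (induce joined_graph (A \<union> B))"
      using \<open>clique joined_graph A\<close> \<open>clique joined_graph B\<close> bridge
      by (intro connected_graph_join connected_graph_clique)
  qed (use bridge in auto)
  moreover have "{e \<in> edges joined_graph. \<exists>u\<in>A. \<exists>v\<in>B. e = {u, v}} = {{a, b}}"
    using disjoint outside bridge by (auto simp: doubleton_in_edges doubleton_eq_iff)
  ultimately show ?thesis using disjoint card_eq by (simp add: pair_of_cliques_def)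
qed

sublocale dominant_pair_of_cliques joined_graph A B
proof
  fix v assume "v \<in> verts joined_graph - (A \<union> B)"
  then have "v = x \<or> v = y" by (auto simp: joined_graph_def)
  then have "neighbours joined_graph v \<subseteq> {x, y} - {v}"
    using bridge outside by (auto simp: neighbours_def doubleton_in_edges doubleton_eq_iff)
  then have "vdegree joined_graph v \<le> card ({x, y} - {v})"
    by (rule vdegree_le_card[OF network_joined_graph]) simp
  also have "\<dots> = 1" using \<open>v = x \<or> v = y\<close> outside by auto
  also have "\<dots> < card A - 1" using card_ge by simp
  finally show "vdegree joined_graph v < card A - 1" .
next
  show "\<exists>e\<in>edges joined_graph. \<not> e \<subseteq> A \<union> B" using outside by (auto simp: joined_graph_def)
qed (rule network_joined_graph pair_of_cliques_joined_graph)+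

end

lemma ex_large_dominant_pair_of_cliques:
  "\<exists>(N :: 'a::infinite graph) A B. dominant_pair_of_cliques N A B \<and> m \<le> card (A \<union> B)"
proof -
  obtain f :: "nat \<Rightarrow> 'a" where inj: "inj f"
    using infinite_countable_subset[OF infinite_UNIV] by blast
  define n where "n = max 3 m"
  let ?A = "f ` {..<n}" and ?B = "f ` {n..<2 * n}"
  have card: "card ?A = n" "card ?B = n"
    using inj by (simp_all add: card_image inj_on_subset)
  have "3 \<le> n" by (simp add: n_def)
  then have "joined_cliques ?A ?B (f 0) (f n) (f (2 * n)) (f (2 * n + 1))"
    by unfold_locales (use card in \<open>auto simp: inj_eq[OF inj]\<close>)
  then interpret joined_cliques ?A ?B "f 0" "f n" "f (2 * n)" "f (2 * n + 1)" .
  have "m \<le> card (?A \<union> ?B)"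
    using card_pair_of_cliques[OF network pair] card(1) by (simp add: n_def)
  then show ?thesis using dominant_pair_of_cliques_axioms by blast
qed

section \<open>Violated axioms\<close>

lemma standard_imp_refinement_consistency:
  "standard_consistency M \<Longrightarrow> refinement_consistency M"
  unfolding standard_consistency_def refinement_consistency_def by blast

lemma connectivity_min_cut_unbounded:
  fixes r :: nat
  assumes "connectivity M"
  shows "\<exists>m. \<forall>N. network N \<longrightarrow> (\<forall>c\<in>M N. m \<le> card c \<longrightarrow> r < min_cut (induce N c))"
proof -
  obtain f :: "real \<Rightarrow> real" where unbounded: "filterlim f at_top at_top"
    and f_less: "\<And>N c. network N \<Longrightarrow> c \<in> M N \<Longrightarrow> 2 \<le> card c \<Longrightarrow>
      f (real (card c)) < real (min_cut (induce N c))"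
    using assms unfolding connectivity_def by blast
  from unbounded have "\<forall>\<^sub>F t in at_top. real r \<le> f t" by (simp add: filterlim_at_top)
  then obtain t where f_ge: "\<And>s. t \<le> s \<Longrightarrow> real r \<le> f s"
    by (auto simp: eventually_at_top_linorder)
  show ?thesis
  proof (intro exI allI ballI impI)
    fix N c
    assume cluster: "network N" "c \<in> M N" and card: "max 2 (nat \<lceil>t\<rceil>) \<le> card c"
    then have "real r \<le> f (real (card c))" by (intro f_ge) linarith
    also have "\<dots> < real (min_cut (induce N c))" using cluster card by (intro f_less) auto
    finally show "r < min_cut (induce N c)" by simp
  qed
qed

lemma not_richness_IKC: "\<not> richness (IKC :: 'a::infinite graph \<Rightarrow> 'a set set)"
proof
  assume rich: "richness (IKC :: 'a graph \<Rightarrow> 'a set set)"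
  obtain V :: "'a set" where doubleton: "finite V" "card V = 2"
    using infinite_arbitrarily_large[OF infinite_UNIV] by blast
  then have "partition_on V {V}" by (intro partition_on_space) auto
  then obtain E where "network (V, E)" "IKC (V, E) = {V}"
    using rich doubleton(1) unfolding richness_def by blast
  then show False using verts_notin_IKC[of "(V, E)"] doubleton(2) by simp
qed

lemma not_connectivity_IKC: "\<not> connectivity (IKC :: 'a::infinite graph \<Rightarrow> 'a set set)"
proof
  assume "connectivity (IKC :: 'a graph \<Rightarrow> 'a set set)"
  then obtain m where cut_gt_1: "\<And>(N :: 'a graph) c. network N \<Longrightarrow> c \<in> IKC N \<Longrightarrow> m \<le> card c \<Longrightarrow>
      1 < min_cut (induce N c)"
    using connectivity_min_cut_unbounded[of IKC 1] by blast
  obtain N :: "'a graph" and A B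
    where dominant: "dominant_pair_of_cliques N A B" and large: "m \<le> card (A \<union> B)"
    using ex_large_dominant_pair_of_cliques by blast
  interpret dominant_pair_of_cliques N A B by (rule dominant)
  show False
    using cut_gt_1[OF network Un_in_IKC large] min_cut_pair_of_cliques[OF network pair] by simp
qed

lemma not_pair_of_cliques_IKC:
  "\<not> pair_of_cliques_axiom (IKC :: 'a::infinite graph \<Rightarrow> 'a set set)"
proof
  assume "pair_of_cliques_axiom (IKC :: 'a graph \<Rightarrow> 'a set set)"
  then obtain m where clusters: "\<And>(N :: 'a graph) A B. network N \<Longrightarrow> pair_of_cliques N A B \<Longrightarrow>
      m \<le> card (A \<union> B) \<Longrightarrow> A \<in> IKC N"
    unfolding pair_of_cliques_axiom_def by blast
  obtain N :: "'a graph" and A B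
    where dominant: "dominant_pair_of_cliques N A B" and large: "m \<le> card (A \<union> B)"
    using ex_large_dominant_pair_of_cliques by blast
  interpret dominant_pair_of_cliques N A B by (rule dominant)
  show False using clusters[OF network pair large] clique_notin_IKC by blast
qed

theorem theorem5:
  shows "\<not> richness (IKC :: 'a::infinite graph \<Rightarrow> 'a set set)
    \<and> \<not> standard_consistency (IKC :: 'a::infinite graph \<Rightarrow> 'a set set)
    \<and> \<not> refinement_consistency (IKC :: 'a::infinite graph \<Rightarrow> 'a set set)
    \<and> \<not> inter_edge_consistency (IKC :: 'a::infinite graph \<Rightarrow> 'a set set)
    \<and> \<not> connectivity (IKC :: 'a::infinite graph \<Rightarrow> 'a set set)
    \<and> \<not> pair_of_cliques_axiom (IKC :: 'a::infinite graph \<Rightarrow> 'a set set)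
    \<and> \<not> fixed_point (IKC :: 'a::infinite graph \<Rightarrow> 'a set set)"
proof -
  obtain N :: "'a graph" and A B where "dominant_pair_of_cliques N A B"
    using ex_large_dominant_pair_of_cliques by blast
  then interpret dominant_pair_of_cliques N A B .
  have "\<not> standard_consistency (IKC :: 'a graph \<Rightarrow> 'a set set)"
    using standard_imp_refinement_consistency not_refinement_consistency_IKC by blast
  then show ?thesis
    using not_richness_IKC not_refinement_consistency_IKC not_inter_edge_consistency_IKC
      not_connectivity_IKC not_pair_of_cliques_IKC not_fixed_point_IKC
    by blast
qed

end
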